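(* Let $(D,\mu)$ be a valuation site. If $(D,\mu)$ is almost Boolean, then the inner locale $L(D,\mu)$ is a measurable locale.
   Context: A frame is a poset with arbitrary suprema and finite infima satisfying $V\wedge\bigvee_i U_i=\bigvee_i(V\wedge U_i)$; a locale $L$ is an object of the opposite category of frames, with frame $\mathcal{O}(L)$. A valuation site $(D,\mu)$ is a lower bounded distributive lattice $D$ (with bottom $0$) together with a finite valuation, i.e. a monotone map $\mu:D\to[0,\infty)$ with $\mu(0)=0$ and $\mu(p)+\mu(q)=\mu(p\vee q)+\mu(p\wedge q)$. A family $\{p_i\le p\}_{i\in I}$ is a $\mu$-inner cover iff for all $\epsilon>0$ there is a finite $F\subset I$ with $\mu(p)-\mu(\bigvee_{i\in F}p_i)<\epsilon$. A $\mu$-ideal is a downward closed subset $U\subset D$ such that $p\in U$ whenever $p$ has a $\mu$-inner cover by elements of $U$. The $\mu$-ideals ordered by inclusion form a frame $\mathrm{Sh}(D,\mu;\mathbf 2)$; $L(D,\mu)$ is the corresponding locale. $(D,\mu)$ is almost Boolean if for any $c\in D$, any ascending sequence $c_0\le c_1\le\cdots\le c$ of elements below $c$, and any $\epsilon>0$, there exist $N\in\mathbb{N}$ and $d\le c$ such that $\mu(d\wedge c_n)=0$ for all $n\in\mathbb{N}$ and $\mu(c)-\mu(d\vee c_N)<\epsilon$. A measure on a locale $L$ is a monotone map $\nu:\mathcal{O}(L)\to[0,\infty]$ with $\nu(0)=0$, $\nu(U)+\nu(V)=\nu(U\vee V)+\nu(U\wedge V)$, and $\nu(\bigvee_iU_i)=\sup_i\nu(U_i)$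 for directed families. It is locally finite if $1$ is a supremum of opens of finite measure, and faithful if whenever $U\le V$ and $\nu(U\wedge K)=\nu(V\wedge K)$ for all $K$ with $\nu(K)<\infty$, then $U=V$. A locale is Boolean if every open has a complement. A Boolean locale is measurable if it admits a locally finite and faithful measure. *)

theory Defs
  imports "HOL-Algebra.Complete_Lattice" "HOL-Library.Extended_Nonnegative_Real"
begin

text \<open>
  A locale (in the sense of point-free topology) is represented by its frame of opens, and a frame
  by an order structure \<open>L\<close> in the sense of HOL-Algebra: the opens are the elements of
  \<^term>\<open>carrier L\<close>. The word "locale" in the names below never refers to Isabelle's locales.
\<close>

section \<open>Frames, Boolean locales and measures on locales\<close>

locale frame = complete_lattice L for L (structure) +
  assumes meet_Sup_distrib:
    "\<lbrakk>V \<in> carrier L; A \<subseteq> carrier L\<rbrakk> \<Longrightarrow> V \<sqinter> (\<Squnion>A) = \<Squnion>((\<lambda>U. V \<sqinter> U) ` A)"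

definition boolean_locale :: "('b, 'c) gorder_scheme \<Rightarrow> bool" where
  "boolean_locale L \<longleftrightarrow> frame L \<and>
     (\<forall>U\<in>carrier L. \<exists>V\<in>carrier L. U \<sqinter>\<^bsub>L\<^esub> V = \<bottom>\<^bsub>L\<^esub> \<and> U \<squnion>\<^bsub>L\<^esub> V = \<top>\<^bsub>L\<^esub>)"

definition directed_family :: "('b, 'c) gorder_scheme \<Rightarrow> 'b set \<Rightarrow> bool" where
  "directed_family L A \<longleftrightarrow> A \<subseteq> carrier L \<and> A \<noteq> {} \<and>
     (\<forall>U\<in>A. \<forall>V\<in>A. \<exists>W\<in>A. U \<sqsubseteq>\<^bsub>L\<^esub> W \<and> V \<sqsubseteq>\<^bsub>L\<^esub> W)"

definition locale_measure :: "('b, 'c) gorder_scheme \<Rightarrow> ('b \<Rightarrow> ennreal) \<Rightarrow> bool" where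
  "locale_measure L \<nu> \<longleftrightarrow>
     (\<forall>U\<in>carrier L. \<forall>V\<in>carrier L. U \<sqsubseteq>\<^bsub>L\<^esub> V \<longrightarrow> \<nu> U \<le> \<nu> V) \<and>
     \<nu> \<bottom>\<^bsub>L\<^esub> = 0 \<and>
     (\<forall>U\<in>carrier L. \<forall>V\<in>carrier L. \<nu> U + \<nu> V = \<nu> (U \<squnion>\<^bsub>L\<^esub> V) + \<nu> (U \<sqinter>\<^bsub>L\<^esub> V)) \<and>
     (\<forall>A. directed_family L A \<longrightarrow> \<nu> (\<Squnion>\<^bsub>L\<^esub>A) = (SUP U\<in>A. \<nu> U))"

definition locally_finite_measure :: "('b, 'c) gorder_scheme \<Rightarrow> ('b \<Rightarrow> ennreal) \<Rightarrow> bool" where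
  "locally_finite_measure L \<nu> \<longleftrightarrow> (\<exists>A. A \<subseteq> {U \<in> carrier L. \<nu> U < \<infinity>} \<and> \<top>\<^bsub>L\<^esub> = \<Squnion>\<^bsub>L\<^esub>A)"

definition faithful_measure :: "('b, 'c) gorder_scheme \<Rightarrow> ('b \<Rightarrow> ennreal) \<Rightarrow> bool" where
  "faithful_measure L \<nu> \<longleftrightarrow>
     (\<forall>U\<in>carrier L. \<forall>V\<in>carrier L. U \<sqsubseteq>\<^bsub>L\<^esub> V \<longrightarrow>
        (\<forall>K\<in>carrier L. \<nu> K < \<infinity> \<longrightarrow> \<nu> (U \<sqinter>\<^bsub>L\<^esub> K) = \<nu> (V \<sqinter>\<^bsub>L\<^esub> K)) \<longrightarrow> U = V)"

definition measurable_locale :: "('b, 'c) gorder_scheme \<Rightarrow> bool" where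
  "measurable_locale L \<longleftrightarrow> boolean_locale L \<and>
     (\<exists>\<nu>. locale_measure L \<nu> \<and> locally_finite_measure L \<nu> \<and> faithful_measure L \<nu>)"

section \<open>Valuation sites and their inner locales\<close>

text \<open>
  The lattice operations on \<open>D\<close> are written \<^term>\<open>sup_class.sup\<close> and \<^term>\<open>inf_class.inf\<close>, since
  the short names may be captured by the suprema and infima of HOL-Algebra.
\<close>

locale valuation_site =
  fixes \<mu> :: "'a :: {distrib_lattice, order_bot} \<Rightarrow> real"
  assumes nonneg: "0 \<le> \<mu> p"
    and mono: "p \<le> q \<Longrightarrow> \<mu> p \<le> \<mu> q"
    and bot: "\<mu> bot = 0"
    and modular: "\<mu> p + \<mu> q = \<mu> (sup_class.sup p q) + \<mu> (inf_class.inf p q)"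

text \<open>
  A covering family is given by the set \<open>P\<close> of its members, as the condition only depends on this
  set. Inserting \<^term>\<open>bot\<close> makes \<^const>\<open>Sup_fin\<close> yield the least element for the empty subfamily,
  without affecting the other finite joins.
\<close>

definition inner_cover :: "('a :: {distrib_lattice, order_bot} \<Rightarrow> real) \<Rightarrow> 'a set \<Rightarrow> 'a \<Rightarrow> bool" where
  "inner_cover \<mu> P p \<longleftrightarrow> (\<forall>q\<in>P. q \<le> p) \<and>
     (\<forall>\<epsilon>>0. \<exists>F. finite F \<and> F \<subseteq> P \<and> \<mu> p - \<mu> (Sup_fin (insert bot F)) < \<epsilon>)"

definition mu_ideal :: "('a :: {distrib_lattice, order_bot} \<Rightarrow> real) \<Rightarrow> 'a set \<Rightarrow> bool" where
  "mu_ideal \<mu> U \<longleftrightarrow> (\<forall>p\<in>U. \<forall>q. q \<le> p \<longrightarrow> q \<in> U) \<and>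
     (\<forall>p. (\<exists>P\<subseteq>U. inner_cover \<mu> P p) \<longrightarrow> p \<in> U)"

definition inner_locale :: "('a :: {distrib_lattice, order_bot} \<Rightarrow> real) \<Rightarrow> 'a set gorder" where
  "inner_locale \<mu> = \<lparr>carrier = {U. mu_ideal \<mu> U}, eq = (=), le = (\<subseteq>)\<rparr>"

definition almost_boolean :: "('a :: {distrib_lattice, order_bot} \<Rightarrow> real) \<Rightarrow> bool" where
  "almost_boolean \<mu> \<longleftrightarrow>
     (\<forall>c (s :: nat \<Rightarrow> 'a) \<epsilon>. (\<forall>n. s n \<le> s (Suc n)) \<longrightarrow> (\<forall>n. s n \<le> c) \<longrightarrow> \<epsilon> > 0 \<longrightarrow>
        (\<exists>N d. d \<le> c \<and> (\<forall>n. \<mu> (inf_class.inf d (s n)) = 0) \<and>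
               \<mu> c - \<mu> (sup_class.sup d (s N)) < \<epsilon>))"

end

theory Submission
  imports Defs
begin

text \<open>
  A cover in a valuation site is a matter of approximation from below, and so is everything else.
  A lattice ideal \<open>I\<close> generates the \<open>\<mu>\<close>-ideal of all \<open>p\<close> that have elements of \<open>I\<close> below them of
  measure arbitrarily close to \<open>\<mu> p\<close> (lemma \<open>mu_ideal_inner_closure\<close>). Hence the join of a family
  of \<open>\<mu>\<close>-ideals consists of the elements that are approximated by finite joins of elements of the
  members, while meets are intersections. As a \<open>\<mu>\<close>-ideal containing \<open>p\<close> contains all approximants
  of \<open>p\<close>, intersecting with it commutes with joins, and the \<open>\<mu>\<close>-ideals form a frame.

  The measure of a \<open>\<mu>\<close>-ideal \<open>U\<close> is the supremum of \<open>\<mu>\<close> over \<open>U\<close>. Approximation in the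
  description of joins costs an arbitrarily small amount of \<open>\<mu>\<close>, so modularity and
  continuity on directed families are inherited from the lattice. The principal \<open>\<mu>\<close>-ideal of \<open>p\<close> has
  measure \<open>\<mu> p\<close>; these ideals are therefore of finite measure, and they cover the top, because \<open>p\<close> is
  a member of its own ideal. They also detect inclusions: if
  \<open>p \<in> V\<close> and \<open>U\<close>, \<open>V\<close> have the same measure within the ideal of \<open>p\<close>, then \<open>U\<close> contains elements
  below \<open>p\<close> of measure close to \<open>\<mu> p\<close>, so that \<open>p \<in> U\<close>.

  Being almost Boolean enters only through complements. The pseudocomplement of \<open>U\<close> consists of
  the elements meeting every element of \<open>U\<close> in a null element. To see that it covers the top
  together with \<open>U\<close>, let \<open>c\<close> be arbitrary and exhaust \<open>U\<close> below \<open>c\<close> in measure by an ascending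
  sequence; this is possible because \<open>\<mu>\<close> is bounded by \<open>\<mu> c\<close> there. An element
  \<open>d\<close> as in the definition of being almost Boolean is null against the sequence, hence against all of
  \<open>U\<close>, since anything that \<open>U\<close> has in \<open>d\<close> could be added to the sequence and increase its measure beyond
  the supremum (lemma \<open>null_against_exhaustion\<close>).
\<close>

notation sup_class.sup (infixl \<open>\<^bold>\<or>\<close> 65)
notation inf_class.inf (infixl \<open>\<^bold>\<and>\<close> 70)

section \<open>Finite joins and lattice ideals\<close>

definition down_closed :: "'a::order set \<Rightarrow> bool" where
  "down_closed A \<longleftrightarrow> (\<forall>p\<in>A. \<forall>q\<le>p. q \<in> A)"

definition lattice_ideal :: "'a::{lattice, order_bot} set \<Rightarrow> bool" where
  "lattice_ideal I \<longleftrightarrow> bot \<in> I \<and> down_closed I \<and> (\<forall>p\<in>I. \<forall>q\<in>I. p \<^bold>\<or> q \<in> I)"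

inductive_set finite_joins :: "'a::{lattice, order_bot} set \<Rightarrow> 'a set" for A where
  bot_in: "bot \<in> finite_joins A"
| sup_in: "a \<in> A \<Longrightarrow> b \<in> finite_joins A \<Longrightarrow> a \<^bold>\<or> b \<in> finite_joins A"

lemma lattice_idealD:
  assumes "lattice_ideal I"
  shows "bot \<in> I" and "p \<in> I \<Longrightarrow> q \<le> p \<Longrightarrow> q \<in> I" and "p \<in> I \<Longrightarrow> q \<in> I \<Longrightarrow> p \<^bold>\<or> q \<in> I"
  using assms by (auto simp: lattice_ideal_def down_closed_def)

lemma bot_sup: "bot \<^bold>\<or> (p::'a::{lattice, order_bot}) = p"
  by (simp add: sup_absorb2)

lemma finite_joins_base: "a \<in> A \<Longrightarrow> a \<in> finite_joins A"
  using sup_in[OF _ bot_in, of a A] by (metis bot_sup sup_commute)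

lemma finite_joins_sup:
  "p \<in> finite_joins A \<Longrightarrow> q \<in> finite_joins A \<Longrightarrow> p \<^bold>\<or> q \<in> finite_joins A"
  by (induction rule: finite_joins.induct) (auto simp: bot_sup sup_assoc intro: sup_in)

text \<open>
  Distributivity of the lattice splits an element below a finite join into a finite join of elements
  below the joinands.
\<close>

lemma finite_joins_below:
  fixes A :: "'a::{distrib_lattice, order_bot} set"
  assumes "down_closed A"
  shows "p \<in> finite_joins A \<Longrightarrow> q \<le> p \<Longrightarrow> q \<in> finite_joins A"
proof (induction arbitrary: q rule: finite_joins.induct)
  case bot_in
  then show ?case
    by (metis bot_unique finite_joins.bot_in)
next
  case (sup_in a b)
  have "q \<^bold>\<and> a \<in> A"
    using assms sup_in.hyps(1) by (auto simp: down_closed_def)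
  moreover have "q \<^bold>\<and> b \<in> finite_joins A"
    by (rule sup_in.IH) simp
  moreover have "q = (q \<^bold>\<and> a) \<^bold>\<or> (q \<^bold>\<and> b)"
    using sup_in.prems by (metis inf_sup_distrib1 inf.absorb1)
  ultimately show ?case
    by (metis finite_joins.sup_in)
qed

lemma lattice_ideal_finite_joins:
  fixes A :: "'a::{distrib_lattice, order_bot} set"
  assumes "down_closed A"
  shows "lattice_ideal (finite_joins A)"
  unfolding lattice_ideal_def down_closed_def
  using finite_joins_below[OF assms] finite_joins_sup bot_in by blast

lemma finite_joins_subset:
  assumes "lattice_ideal I" "A \<subseteq> I"
  shows "finite_joins A \<subseteq> I"
proof
  fix p assume "p \<in> finite_joins A"
  then show "p \<in> I"
    by induction (use assms lattice_idealD in blast)+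
qed

text \<open>
  The source of the frame law: the joinands of an element of a downward closed set belong to the set
  themselves.
\<close>

lemma finite_joins_Int:
  assumes "down_closed V"
  shows "p \<in> finite_joins A \<Longrightarrow> p \<in> V \<Longrightarrow> p \<in> finite_joins (V \<inter> A)"
proof (induction rule: finite_joins.induct)
  case bot_in
  show ?case
    by (rule finite_joins.bot_in)
next
  case (sup_in a b)
  then have "a \<in> V" "b \<in> V"
    using assms by (auto simp: down_closed_def)
  with sup_in show ?case
    by (auto intro: finite_joins.sup_in)
qed

lemma finite_joins_Un:
  assumes "lattice_ideal I" "lattice_ideal J" "p \<in> finite_joins (I \<union> J)"
  obtains u v where "u \<in> I" "v \<in> J" "p = u \<^bold>\<or> v"
proof -
  from assms(3) have "\<exists>u\<in>I. \<exists>v\<in>J. p = u \<^bold>\<or> v"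
  proof induction
    case bot_in
    then show ?case
      using assms(1,2) by (metis bot_sup lattice_idealD(1))
  next
    case (sup_in a b)
    then obtain u v where uv: "u \<in> I" "v \<in> J" "b = u \<^bold>\<or> v"
      by blast
    from sup_in.hyps(1) show ?case
    proof
      assume "a \<in> I"
      then have "a \<^bold>\<or> u \<in> I" "a \<^bold>\<or> b = (a \<^bold>\<or> u) \<^bold>\<or> v"
        using uv assms(1) by (auto simp: sup_assoc dest: lattice_idealD(3))
      with uv show ?thesis
        by blast
    next
      assume "a \<in> J"
      then have "a \<^bold>\<or> v \<in> J" "a \<^bold>\<or> b = u \<^bold>\<or> (a \<^bold>\<or> v)"
        using uv assms(2) by (auto simp: sup_left_commute dest: lattice_idealD(3))
      with uv show ?thesis
        by blast
    qed
  qed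
  with that show thesis
    by blast
qed

lemma finite_joins_directed:
  assumes "A \<noteq> {}" "\<And>U. U \<in> A \<Longrightarrow> lattice_ideal U"
    and "\<And>U V. U \<in> A \<Longrightarrow> V \<in> A \<Longrightarrow> \<exists>W\<in>A. U \<subseteq> W \<and> V \<subseteq> W"
    and "p \<in> finite_joins (\<Union>A)"
  shows "\<exists>U\<in>A. p \<in> U"
  using assms(4)
proof induction
  case bot_in
  then show ?case
    using assms(1,2) lattice_idealD(1) by blast
next
  case (sup_in a b)
  then obtain U V where "U \<in> A" "a \<in> U" "V \<in> A" "b \<in> V"
    by blast
  moreover from this obtain W where "W \<in> A" "U \<subseteq> W" "V \<subseteq> W"
    using assms(3) by blast
  ultimately show ?case
    using assms(2) lattice_idealD(3) by (metis subsetD)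
qed

section \<open>Approximation from below\<close>

definition inner_closure :: "('a::order \<Rightarrow> real) \<Rightarrow> 'a set \<Rightarrow> 'a set" where
  "inner_closure \<mu> I = {p. \<forall>\<epsilon>>0. \<exists>q\<in>I. q \<le> p \<and> \<mu> p - \<mu> q < \<epsilon>}"

lemma inner_closureI:
  "(\<And>\<epsilon>. \<epsilon> > 0 \<Longrightarrow> \<exists>q\<in>I. q \<le> p \<and> \<mu> p - \<mu> q < \<epsilon>) \<Longrightarrow> p \<in> inner_closure \<mu> I"
  by (simp add: inner_closure_def)

lemma inner_closureE:
  assumes "p \<in> inner_closure \<mu> I" "\<epsilon> > 0"
  obtains q where "q \<in> I" "q \<le> p" "\<mu> p - \<mu> q < \<epsilon>"
  using assms by (auto simp: inner_closure_def)

lemma inner_closure_increasing: "I \<subseteq> inner_closure \<mu> I"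
  by (force simp: inner_closure_def)

lemma inner_closure_mono: "I \<subseteq> J \<Longrightarrow> inner_closure \<mu> I \<subseteq> inner_closure \<mu> J"
  by (force simp: inner_closure_def)

lemma inner_closure_idem: "inner_closure \<mu> (inner_closure \<mu> I) = inner_closure \<mu> I"
proof
  show "inner_closure \<mu> (inner_closure \<mu> I) \<subseteq> inner_closure \<mu> I"
  proof (intro subsetI inner_closureI)
    fix p and \<epsilon> :: real
    assume p: "p \<in> inner_closure \<mu> (inner_closure \<mu> I)" and "\<epsilon> > 0"
    then have "\<epsilon> / 2 > 0"
      by simp
    with p obtain q where q: "q \<in> inner_closure \<mu> I" "q \<le> p" "\<mu> p - \<mu> q < \<epsilon> / 2"
      by (rule inner_closureE)
    from q(1) \<open>\<epsilon> / 2 > 0\<close> obtain r where r: "r \<in> I" "r \<le> q" "\<mu> q - \<mu> r < \<epsilon> / 2"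
      by (rule inner_closureE)
    have "\<mu> p - \<mu> r < \<epsilon>"
      using q(3) r(3) by linarith
    with q r show "\<exists>r\<in>I. r \<le> p \<and> \<mu> p - \<mu> r < \<epsilon>"
      by (meson order_trans)
  qed
qed (rule inner_closure_increasing)

context valuation_site
begin

text \<open>
  Joining or meeting with a fixed element does not increase differences of \<open>\<mu>\<close> along \<open>q \<le> p\<close>: by
  modularity the two differences add up to \<open>\<mu> p - \<mu> q\<close>.
\<close>

lemma
  assumes "q \<le> p"
  shows sup_diff_le: "\<mu> (p \<^bold>\<or> r) - \<mu> (q \<^bold>\<or> r) \<le> \<mu> p - \<mu> q"
    and inf_diff_le: "\<mu> (p \<^bold>\<and> r) - \<mu> (q \<^bold>\<and> r) \<le> \<mu> p - \<mu> q"
proof -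
  have "\<mu> (q \<^bold>\<and> r) \<le> \<mu> (p \<^bold>\<and> r)" "\<mu> (q \<^bold>\<or> r) \<le> \<mu> (p \<^bold>\<or> r)"
    using assms by (auto intro!: mono inf_mono sup_mono)
  then show "\<mu> (p \<^bold>\<or> r) - \<mu> (q \<^bold>\<or> r) \<le> \<mu> p - \<mu> q" "\<mu> (p \<^bold>\<and> r) - \<mu> (q \<^bold>\<and> r) \<le> \<mu> p - \<mu> q"
    using modular[of p r] modular[of q r] by linarith+
qed

lemma lattice_ideal_inner_closure:
  assumes I: "lattice_ideal I"
  shows "lattice_ideal (inner_closure \<mu> I)"
  unfolding lattice_ideal_def down_closed_def
proof (intro conjI ballI allI impI)
  show "bot \<in> inner_closure \<mu> I"
    using inner_closure_increasing lattice_idealD(1)[OF I] by blast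
next
  fix p q assume p: "p \<in> inner_closure \<mu> I" and le: "q \<le> p"
  show "q \<in> inner_closure \<mu> I"
  proof (rule inner_closureI)
    fix \<epsilon> :: real assume "\<epsilon> > 0"
    with p obtain r where r: "r \<in> I" "r \<le> p" "\<mu> p - \<mu> r < \<epsilon>"
      by (rule inner_closureE)
    have "r \<^bold>\<and> q \<in> I"
      using r(1) lattice_idealD(2)[OF I] by (meson inf_le1)
    moreover have "\<mu> q - \<mu> (r \<^bold>\<and> q) < \<epsilon>"
      using inf_diff_le[OF r(2), of q] r(3) le by (simp add: inf_absorb2)
    ultimately show "\<exists>r\<in>I. r \<le> q \<and> \<mu> q - \<mu> r < \<epsilon>"
      by (meson inf_le2)
  qed
next
  fix p q assume p: "p \<in> inner_closure \<mu> I" and q: "q \<in> inner_closure \<mu> I"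
  show "p \<^bold>\<or> q \<in> inner_closure \<mu> I"
  proof (rule inner_closureI)
    fix \<epsilon> :: real assume "\<epsilon> > 0"
    then have half: "\<epsilon> / 2 > 0"
      by simp
    from p half obtain r where r: "r \<in> I" "r \<le> p" "\<mu> p - \<mu> r < \<epsilon> / 2"
      by (rule inner_closureE)
    from q half obtain s where s: "s \<in> I" "s \<le> q" "\<mu> q - \<mu> s < \<epsilon> / 2"
      by (rule inner_closureE)
    have "\<mu> (p \<^bold>\<or> q) - \<mu> (r \<^bold>\<or> s) < \<epsilon>"
      using sup_diff_le[OF r(2), of q] sup_diff_le[OF s(2), of r] r(3) s(3)
      by (simp add: sup_commute)
    moreover have "r \<^bold>\<or> s \<in> I" "r \<^bold>\<or> s \<le> p \<^bold>\<or> q"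
      using r(1,2) s(1,2) lattice_idealD(3)[OF I] by (blast, blast intro: sup_mono)
    ultimately show "\<exists>r\<in>I. r \<le> p \<^bold>\<or> q \<and> \<mu> (p \<^bold>\<or> q) - \<mu> r < \<epsilon>"
      by blast
  qed
qed

text \<open>
  An inner cover by elements of a lattice ideal is the same as approximation by single elements of
  the ideal, as finite subfamilies may be replaced by their joins.
\<close>

lemma mu_ideal_iff: "mu_ideal \<mu> U \<longleftrightarrow> lattice_ideal U \<and> inner_closure \<mu> U \<subseteq> U"
proof
  assume U: "mu_ideal \<mu> U"
  then have down: "\<And>p q. p \<in> U \<Longrightarrow> q \<le> p \<Longrightarrow> q \<in> U"
    and cover: "\<And>P p. P \<subseteq> U \<Longrightarrow> inner_cover \<mu> P p \<Longrightarrow> p \<in> U"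
    unfolding mu_ideal_def by blast+
  have "bot \<in> U"
    by (rule cover[of "{}"]) (auto simp: inner_cover_def)
  moreover have "p \<^bold>\<or> q \<in> U" if "p \<in> U" "q \<in> U" for p q
  proof (rule cover[of "{p, q}"])
    show "inner_cover \<mu> {p, q} (p \<^bold>\<or> q)"
      unfolding inner_cover_def
    proof (intro conjI allI impI)
      fix \<epsilon> :: real assume "\<epsilon> > 0"
      then show "\<exists>F. finite F \<and> F \<subseteq> {p, q} \<and> \<mu> (p \<^bold>\<or> q) - \<mu> (Sup_fin (insert bot F)) < \<epsilon>"
        by (intro exI[of _ "{p, q}"]) (simp add: bot_sup)
    qed auto
  qed (use that in auto)
  moreover have "inner_closure \<mu> U \<subseteq> U"
  proof
    fix p assume p: "p \<in> inner_closure \<mu> U"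
    show "p \<in> U"
    proof (rule cover[of "{q \<in> U. q \<le> p}"])
      show "inner_cover \<mu> {q \<in> U. q \<le> p} p"
        unfolding inner_cover_def
      proof (intro conjI allI impI)
        fix \<epsilon> :: real assume "\<epsilon> > 0"
        with p obtain q where "q \<in> U" "q \<le> p" "\<mu> p - \<mu> q < \<epsilon>"
          by (rule inner_closureE)
        then show "\<exists>F. finite F \<and> F \<subseteq> {q \<in> U. q \<le> p} \<and> \<mu> p - \<mu> (Sup_fin (insert bot F)) < \<epsilon>"
          by (intro exI[of _ "{q}"]) (simp add: bot_sup)
      qed auto
    qed auto
  qed
  ultimately show "lattice_ideal U \<and> inner_closure \<mu> U \<subseteq> U"
    using down unfolding lattice_ideal_def down_closed_def by blast
next
  assume U: "lattice_ideal U \<and> inner_closure \<mu> U \<subseteq> U"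
  then have ideal: "lattice_ideal U"
    by blast
  have "p \<in> U" if "P \<subseteq> U" "inner_cover \<mu> P p" for P p
  proof -
    have "p \<in> inner_closure \<mu> U"
    proof (rule inner_closureI)
      fix \<epsilon> :: real assume "\<epsilon> > 0"
      with that obtain F where F: "finite F" "F \<subseteq> P" "\<mu> p - \<mu> (Sup_fin (insert bot F)) < \<epsilon>"
        unfolding inner_cover_def by blast
      have "\<And>q. q \<in> F \<Longrightarrow> q \<le> p"
        using that(2) F(2) by (auto simp: inner_cover_def)
      then have "Sup_fin (insert bot F) \<le> p"
        using F(1) by (intro Sup_fin.boundedI) auto
      moreover have "Sup_fin (insert bot F) \<in> U"
      proof -
        have "F \<subseteq> U"
          using F(2) that(1) by blast
        with F(1) show ?thesis
        proof (induction F rule: finite_induct)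
          case empty
          then show ?case
            by (simp add: lattice_idealD(1)[OF ideal])
        next
          case (insert x F)
          then have "Sup_fin (insert bot (insert x F)) = x \<^bold>\<or> Sup_fin (insert bot F)"
            by (metis Sup_fin.insert finite.insertI insert_commute insert_not_empty)
          with insert show ?case
            by (simp add: lattice_idealD(3)[OF ideal])
        qed
      qed
      ultimately show "\<exists>q\<in>U. q \<le> p \<and> \<mu> p - \<mu> q < \<epsilon>"
        using F(3) by blast
    qed
    with U show ?thesis
      by blast
  qed
  then show "mu_ideal \<mu> U"
    unfolding mu_ideal_def using lattice_idealD(2)[OF ideal] by blast
qed

lemma mu_ideal_inner_closure: "lattice_ideal I \<Longrightarrow> mu_ideal \<mu> (inner_closure \<mu> I)"
  by (simp add: mu_ideal_iff lattice_ideal_inner_closure inner_closure_idem)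

lemma mu_ideal_lattice_ideal: "mu_ideal \<mu> U \<Longrightarrow> lattice_ideal U"
  by (simp add: mu_ideal_iff)

lemma mu_ideal_closed: "mu_ideal \<mu> U \<Longrightarrow> p \<in> inner_closure \<mu> U \<Longrightarrow> p \<in> U"
  by (auto simp: mu_ideal_iff)

section \<open>The frame of \<open>\<mu>\<close>-ideals\<close>

definition ideal_join :: "'a set set \<Rightarrow> 'a set" where
  "ideal_join A = inner_closure \<mu> (finite_joins (\<Union>A))"

definition null_ideal :: "'a set" where
  "null_ideal = {p. \<mu> p = 0}"

lemma mu_ideal_join:
  assumes "\<And>U. U \<in> A \<Longrightarrow> mu_ideal \<mu> U"
  shows "mu_ideal \<mu> (ideal_join A)"
proof -
  have "down_closed (\<Union>A)"
    using assms unfolding down_closed_def mu_ideal_def by blast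
  then show ?thesis
    unfolding ideal_join_def by (intro mu_ideal_inner_closure lattice_ideal_finite_joins)
qed

lemma ideal_join_upper: "U \<in> A \<Longrightarrow> U \<subseteq> ideal_join A"
  unfolding ideal_join_def using inner_closure_increasing finite_joins_base by blast

lemma ideal_join_least:
  assumes "mu_ideal \<mu> V" "\<And>U. U \<in> A \<Longrightarrow> U \<subseteq> V"
  shows "ideal_join A \<subseteq> V"
proof -
  have "finite_joins (\<Union>A) \<subseteq> V"
    by (rule finite_joins_subset) (use assms mu_ideal_lattice_ideal in auto)
  then show ?thesis
    unfolding ideal_join_def using assms(1) inner_closure_mono mu_ideal_closed by blast
qed

lemma mu_ideal_Inter:
  assumes "\<And>U. U \<in> A \<Longrightarrow> mu_ideal \<mu> U"
  shows "mu_ideal \<mu> (\<Inter>A)"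
  using assms unfolding mu_ideal_def by (metis Inter_iff le_Inf_iff)

lemma mu_ideal_Int: "mu_ideal \<mu> U \<Longrightarrow> mu_ideal \<mu> V \<Longrightarrow> mu_ideal \<mu> (U \<inter> V)"
  using mu_ideal_Inter[of "{U, V}"] by auto

lemma mu_ideal_UNIV: "mu_ideal \<mu> UNIV"
  using mu_ideal_Inter[of "{}"] by simp

lemma mu_zeroI:
  assumes "\<And>\<epsilon>. \<epsilon> > 0 \<Longrightarrow> \<mu> p < \<epsilon>"
  shows "\<mu> p = 0"
  using nonneg[of p] assms[of "\<mu> p"] by linarith

text \<open>The closure of the zero ideal: an element is null iff the empty family covers it.\<close>

lemma null_ideal_eq: "null_ideal = inner_closure \<mu> {bot}"
proof -
  have "(\<forall>\<epsilon>>0. \<mu> p < \<epsilon>) \<longleftrightarrow> \<mu> p = 0" for p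
    by (auto intro: mu_zeroI)
  then show ?thesis
    by (simp add: null_ideal_def inner_closure_def bot)
qed

lemma mu_ideal_null_ideal: "mu_ideal \<mu> null_ideal"
  unfolding null_ideal_eq
  by (rule mu_ideal_inner_closure) (auto simp: lattice_ideal_def down_closed_def bot_unique)

lemma null_ideal_least: "mu_ideal \<mu> U \<Longrightarrow> null_ideal \<subseteq> U"
  unfolding null_ideal_eq
  using inner_closure_mono[of "{bot}" U \<mu>] mu_ideal_closed lattice_idealD(1)[OF mu_ideal_lattice_ideal]
  by blast

abbreviation opens :: "'a set gorder" where
  "opens \<equiv> inner_locale \<mu>"

lemma carrier_opens [simp]: "U \<in> carrier opens \<longleftrightarrow> mu_ideal \<mu> U"
  and le_opens [simp]: "U \<sqsubseteq>\<^bsub>opens\<^esub> V \<longleftrightarrow> U \<subseteq> V"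
  and eq_opens [simp]: "U .=\<^bsub>opens\<^esub> V \<longleftrightarrow> U = V"
  by (simp_all add: inner_locale_def)

lemma subset_carrier_opens [simp]: "A \<subseteq> carrier opens \<longleftrightarrow> (\<forall>U\<in>A. mu_ideal \<mu> U)"
  by auto

lemma is_lub_ideal_join:
  assumes "A \<subseteq> carrier opens"
  shows "is_lub opens (ideal_join A) A"
proof (rule least_UpperI)
  fix V assume "V \<in> Upper opens A"
  then have "mu_ideal \<mu> V" "\<And>U. U \<in> A \<Longrightarrow> U \<subseteq> V"
    using assms by (auto simp: Upper_def)
  then show "ideal_join A \<sqsubseteq>\<^bsub>opens\<^esub> V"
    by (simp add: ideal_join_least)
qed (use assms in \<open>simp_all add: ideal_join_upper mu_ideal_join\<close>)

lemma is_glb_Inter: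
  assumes "A \<subseteq> carrier opens"
  shows "is_glb opens (\<Inter>A) A"
proof (rule greatest_LowerI)
  show "V \<sqsubseteq>\<^bsub>opens\<^esub> \<Inter>A" if "V \<in> Lower opens A" for V
    using that assms by (simp add: Lower_def subset_iff)
qed (use assms in \<open>simp_all add: Inter_lower mu_ideal_Inter\<close>)

lemma partial_order_opens: "partial_order opens"
proof
  show "x \<sqsubseteq>\<^bsub>opens\<^esub> z \<longleftrightarrow> y \<sqsubseteq>\<^bsub>opens\<^esub> w" if "x .=\<^bsub>opens\<^esub> y" "z .=\<^bsub>opens\<^esub> w" for x y z w
    using that by (simp only: eq_opens)
  show "(.=\<^bsub>opens\<^esub>) = (=)"
    by (intro ext) simp
qed simp_all

lemma complete_lattice_opens: "complete_lattice opens"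
proof (intro complete_lattice.intro complete_lattice_axioms.intro partial_order_opens)
  show "\<exists>s. is_lub opens s A" if "A \<subseteq> carrier opens" for A
    using is_lub_ideal_join[OF that] by blast
  show "\<exists>i. is_glb opens i A" if "A \<subseteq> carrier opens" for A
    using is_glb_Inter[OF that] by blast
qed

lemma Sup_opens:
  assumes "A \<subseteq> carrier opens"
  shows "\<Squnion>\<^bsub>opens\<^esub>A = ideal_join A"
  unfolding sup_def using is_lub_ideal_join[OF assms]
  by (rule some_equality)
    (rule partial_order.least_unique[OF partial_order_opens _ is_lub_ideal_join[OF assms]])

lemma Inf_opens:
  assumes "A \<subseteq> carrier opens"
  shows "\<Sqinter>\<^bsub>opens\<^esub>A = \<Inter>A"
  unfolding inf_def using is_glb_Inter[OF assms]
  by (rule some_equality)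
    (rule partial_order.greatest_unique[OF partial_order_opens _ is_glb_Inter[OF assms]])

lemma join_opens: "mu_ideal \<mu> U \<Longrightarrow> mu_ideal \<mu> V \<Longrightarrow> U \<squnion>\<^bsub>opens\<^esub> V = ideal_join {U, V}"
  by (simp add: join_def Sup_opens)

lemma meet_opens: "mu_ideal \<mu> U \<Longrightarrow> mu_ideal \<mu> V \<Longrightarrow> U \<sqinter>\<^bsub>opens\<^esub> V = U \<inter> V"
  by (simp add: meet_def Inf_opens)

lemma top_opens: "\<top>\<^bsub>opens\<^esub> = UNIV"
proof -
  have "greatest opens UNIV (carrier opens)"
    by (simp add: greatest_def mu_ideal_UNIV)
  then show ?thesis
    unfolding top_def
    by (intro some_equality) (auto dest: partial_order.greatest_unique[OF partial_order_opens])
qed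

lemma bottom_opens: "\<bottom>\<^bsub>opens\<^esub> = null_ideal"
proof -
  have "least opens null_ideal (carrier opens)"
    by (simp add: least_def mu_ideal_null_ideal null_ideal_least)
  then show ?thesis
    unfolding bottom_def
    by (intro some_equality) (auto dest: partial_order.least_unique[OF partial_order_opens])
qed

lemma Int_ideal_join:
  assumes V: "mu_ideal \<mu> V"
  shows "V \<inter> ideal_join A \<subseteq> ideal_join ((\<lambda>U. V \<inter> U) ` A)"
proof
  fix p assume p: "p \<in> V \<inter> ideal_join A"
  have down: "down_closed V"
    using V by (auto simp: mu_ideal_iff lattice_ideal_def)
  have eq: "\<Union>((\<lambda>U. V \<inter> U) ` A) = V \<inter> \<Union>A"
    by blast
  show "p \<in> ideal_join ((\<lambda>U. V \<inter> U) ` A)"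
    unfolding ideal_join_def eq
  proof (rule inner_closureI)
    fix \<epsilon> :: real assume "\<epsilon> > 0"
    with p obtain q where q: "q \<in> finite_joins (\<Union>A)" "q \<le> p" "\<mu> p - \<mu> q < \<epsilon>"
      unfolding ideal_join_def by (auto elim: inner_closureE)
    moreover have "q \<in> V"
      using p q(2) down by (auto simp: down_closed_def)
    ultimately show "\<exists>q\<in>finite_joins (V \<inter> \<Union>A). q \<le> p \<and> \<mu> p - \<mu> q < \<epsilon>"
      using finite_joins_Int[OF down] by blast
  qed
qed

lemma frame_opens: "frame opens"
proof (intro frame.intro frame_axioms.intro complete_lattice_opens)
  fix V A assume V: "V \<in> carrier opens" and A: "A \<subseteq> carrier opens"
  have img: "(\<lambda>U. V \<sqinter>\<^bsub>opens\<^esub> U) ` A = (\<lambda>U. V \<inter> U) ` A"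
    using V A by (intro image_cong) (auto simp: meet_opens)
  have B: "(\<lambda>U. V \<inter> U) ` A \<subseteq> carrier opens"
    using V A by (auto intro: mu_ideal_Int)
  have "ideal_join ((\<lambda>U. V \<inter> U) ` A) \<subseteq> V \<inter> ideal_join A"
    using V A
    by (intro ideal_join_least mu_ideal_Int mu_ideal_join) (auto dest: ideal_join_upper)
  then have "V \<inter> ideal_join A = ideal_join ((\<lambda>U. V \<inter> U) ` A)"
    using Int_ideal_join[of V A] V by auto
  moreover have "mu_ideal \<mu> (ideal_join A)"
    using A by (intro mu_ideal_join) auto
  ultimately show "V \<sqinter>\<^bsub>opens\<^esub> (\<Squnion>\<^bsub>opens\<^esub>A) = \<Squnion>\<^bsub>opens\<^esub>((\<lambda>U. V \<sqinter>\<^bsub>opens\<^esub> U) ` A)"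
    using V by (simp only: img Sup_opens[OF A] Sup_opens[OF B] meet_opens carrier_opens)
qed

section \<open>Complements\<close>

definition pseudocomplement :: "'a set \<Rightarrow> 'a set" where
  "pseudocomplement U = {p. \<forall>u\<in>U. \<mu> (p \<^bold>\<and> u) = 0}"

lemma null_below: "\<mu> p = 0 \<Longrightarrow> q \<le> p \<Longrightarrow> \<mu> q = 0"
  using mono[of q p] nonneg[of q] by simp

lemma mu_ideal_pseudocomplement: "mu_ideal \<mu> (pseudocomplement U)"
  unfolding mu_ideal_iff lattice_ideal_def down_closed_def
proof (intro conjI ballI allI impI subsetI)
  show "bot \<in> pseudocomplement U"
    using null_below[OF bot] by (simp add: pseudocomplement_def)
next
  fix p q assume "p \<in> pseudocomplement U" "q \<le> p"
  then show "q \<in> pseudocomplement U"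
    unfolding pseudocomplement_def using null_below inf_mono[OF _ order_refl] by blast
next
  fix p q assume pq: "p \<in> pseudocomplement U" "q \<in> pseudocomplement U"
  have "\<mu> ((p \<^bold>\<or> q) \<^bold>\<and> u) = 0" if "u \<in> U" for u
    using that pq modular[of "p \<^bold>\<and> u" "q \<^bold>\<and> u"] nonneg[of "(p \<^bold>\<and> u) \<^bold>\<and> (q \<^bold>\<and> u)"]
      nonneg[of "(p \<^bold>\<and> u) \<^bold>\<or> (q \<^bold>\<and> u)"]
    by (simp add: pseudocomplement_def inf_sup_distrib2)
  then show "p \<^bold>\<or> q \<in> pseudocomplement U"
    by (simp add: pseudocomplement_def)
next
  fix p assume p: "p \<in> inner_closure \<mu> (pseudocomplement U)"
  have "\<mu> (p \<^bold>\<and> u) = 0" if "u \<in> U" for u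
  proof (rule mu_zeroI)
    fix \<epsilon> :: real assume "\<epsilon> > 0"
    with p obtain q where q: "q \<in> pseudocomplement U" "q \<le> p" "\<mu> p - \<mu> q < \<epsilon>"
      by (rule inner_closureE)
    then show "\<mu> (p \<^bold>\<and> u) < \<epsilon>"
      using inf_diff_le[OF q(2), of u] that by (simp add: pseudocomplement_def)
  qed
  then show "p \<in> pseudocomplement U"
    by (simp add: pseudocomplement_def)
qed

lemma Int_pseudocomplement:
  assumes "mu_ideal \<mu> U"
  shows "U \<inter> pseudocomplement U = null_ideal"
proof
  show "U \<inter> pseudocomplement U \<subseteq> null_ideal"
    by (auto simp: pseudocomplement_def null_ideal_def dest: bspec)
  show "null_ideal \<subseteq> U \<inter> pseudocomplement U"
    using assms by (intro null_ideal_least mu_ideal_Int mu_ideal_pseudocomplement)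
qed

lemma ascending_exhaustion:
  assumes U: "lattice_ideal U"
  obtains s :: "nat \<Rightarrow> 'a" where "\<And>n. s n \<le> s (Suc n)" "\<And>n. s n \<in> U" "\<And>n. s n \<le> c"
    "\<And>\<epsilon>. \<epsilon> > 0 \<Longrightarrow> \<exists>n. \<forall>u\<in>U. u \<le> c \<longrightarrow> \<mu> u - \<mu> (s n) < \<epsilon>"
proof -
  define X where "X = \<mu> ` {u \<in> U. u \<le> c}"
  have bdd: "bdd_above X"
    unfolding X_def by (rule bdd_aboveI[of _ "\<mu> c"]) (auto intro: mono)
  have "bot \<in> {u \<in> U. u \<le> c}"
    using lattice_idealD(1)[OF U] by simp
  then have ne: "X \<noteq> {}"
    unfolding X_def by blast
  have "\<exists>u. u \<in> U \<and> u \<le> c \<and> Sup X - 1 / Suc n < \<mu> u" for n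
  proof -
    have "Sup X - 1 / Suc n < Sup X"
      by simp
    then show ?thesis
      using less_cSup_iff[OF ne bdd] unfolding X_def by auto
  qed
  then obtain t where t: "\<And>n. t n \<in> U" "\<And>n. t n \<le> c" "\<And>n. Sup X - 1 / Suc n < \<mu> (t n)"
    by metis
  \<comment> \<open>The elements \<open>t n\<close> exhaust \<open>U\<close> below \<open>c\<close>; their partial joins do so in ascending order.\<close>
  define s where "s = rec_nat (t 0) (\<lambda>n x. x \<^bold>\<or> t (Suc n))"
  have s_simps: "s 0 = t 0" "s (Suc n) = s n \<^bold>\<or> t (Suc n)" for n
    by (simp_all add: s_def)
  show thesis
  proof (rule that[of s])
    show "s n \<le> s (Suc n)" for n
      by (simp add: s_simps)
    show "s n \<in> U" for n
      by (induction n) (auto simp: s_simps t intro: lattice_idealD(3)[OF U])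
    show "s n \<le> c" for n
      by (induction n) (auto simp: s_simps t)
    show "\<exists>n. \<forall>u\<in>U. u \<le> c \<longrightarrow> \<mu> u - \<mu> (s n) < \<epsilon>" if "\<epsilon> > 0" for \<epsilon>
    proof -
      obtain n where n: "1 / Suc n < \<epsilon>"
        using nat_approx_posE[OF \<open>\<epsilon> > 0\<close>] by blast
      have "\<mu> u - \<mu> (s n) < \<epsilon>" if "u \<in> U" "u \<le> c" for u
      proof -
        have "\<mu> u \<le> Sup X"
          using that by (intro cSup_upper bdd) (auto simp: X_def)
        moreover have "\<mu> (t n) \<le> \<mu> (s n)"
          by (rule mono) (cases n; simp add: s_simps)
        ultimately show ?thesis
          using t(3)[of n] n by linarith
      qed
      then show ?thesis
        by blast
    qed
  qed
qed

text \<open>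
  If \<open>d \<^bold>\<and> u\<close> had positive measure, joining it to \<open>s n\<close> would add this measure to \<open>\<mu> (s n)\<close>, as the two
  are disjoint up to null elements. For large \<open>n\<close> the join would then exceed the supremum of \<open>\<mu>\<close> on
  the elements of \<open>U\<close> below \<open>c\<close>.
\<close>

lemma null_against_exhaustion:
  assumes U: "lattice_ideal U" "u \<in> U" and s: "\<And>n. s n \<in> U" "\<And>n. s n \<le> c"
    and exhaust: "\<And>\<epsilon>. \<epsilon> > 0 \<Longrightarrow> \<exists>n::nat. \<forall>u\<in>U. u \<le> c \<longrightarrow> \<mu> u - \<mu> (s n) < \<epsilon>"
    and d: "d \<le> c" "\<And>n. \<mu> (d \<^bold>\<and> s n) = 0"
  shows "\<mu> (d \<^bold>\<and> u) = 0"
proof (rule mu_zeroI)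
  fix \<epsilon> :: real assume "\<epsilon> > 0"
  then obtain n where n: "\<And>u. u \<in> U \<Longrightarrow> u \<le> c \<Longrightarrow> \<mu> u - \<mu> (s n) < \<epsilon>"
    using exhaust by blast
  have "d \<^bold>\<and> u \<in> U"
    using U by (meson inf_le2 lattice_idealD(2))
  then have "s n \<^bold>\<or> (d \<^bold>\<and> u) \<in> U"
    using s(1) U(1) lattice_idealD(3) by blast
  moreover have "s n \<^bold>\<or> (d \<^bold>\<and> u) \<le> c"
    using s(2) d(1) by (simp add: le_infI1)
  moreover have "\<mu> (s n \<^bold>\<and> (d \<^bold>\<and> u)) = 0"
    by (rule null_below[OF d(2)[of n]]) (simp add: le_infI1 le_infI2)
  ultimately show "\<mu> (d \<^bold>\<and> u) < \<epsilon>"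
    using n[of "s n \<^bold>\<or> (d \<^bold>\<and> u)"] modular[of "s n" "d \<^bold>\<and> u"] by linarith
qed

lemma join_pseudocomplement:
  assumes "almost_boolean \<mu>" and U: "mu_ideal \<mu> U"
  shows "ideal_join {U, pseudocomplement U} = UNIV"
proof -
  have ideal: "lattice_ideal U"
    by (rule mu_ideal_lattice_ideal[OF U])
  have "c \<in> ideal_join {U, pseudocomplement U}" for c
    unfolding ideal_join_def
  proof (rule inner_closureI)
    fix \<epsilon> :: real assume "\<epsilon> > 0"
    obtain s :: "nat \<Rightarrow> 'a" where s: "\<And>n. s n \<le> s (Suc n)" "\<And>n. s n \<in> U" "\<And>n. s n \<le> c"
      and exhaust: "\<And>\<epsilon>. \<epsilon> > 0 \<Longrightarrow> \<exists>n. \<forall>u\<in>U. u \<le> c \<longrightarrow> \<mu> u - \<mu> (s n) < \<epsilon>"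
      using ascending_exhaustion[OF ideal] by blast
    obtain N d where d: "d \<le> c" "\<And>n. \<mu> (d \<^bold>\<and> s n) = 0" "\<mu> c - \<mu> (d \<^bold>\<or> s N) < \<epsilon>"
      using assms(1) s(1,3) \<open>\<epsilon> > 0\<close> unfolding almost_boolean_def by blast
    have "d \<in> pseudocomplement U"
      unfolding pseudocomplement_def
      using null_against_exhaustion[OF ideal _ s(2,3) exhaust d(1,2)] by blast
    then have "d \<^bold>\<or> s N \<in> finite_joins (\<Union>{U, pseudocomplement U})"
      using s(2) by (intro finite_joins_sup finite_joins_base) auto
    then show "\<exists>q\<in>finite_joins (\<Union>{U, pseudocomplement U}). q \<le> c \<and> \<mu> c - \<mu> q < \<epsilon>"
      using d s(3) by (intro bexI[of _ "d \<^bold>\<or> s N"]) auto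
  qed
  then show ?thesis
    by blast
qed

lemma boolean_locale_opens:
  assumes "almost_boolean \<mu>"
  shows "boolean_locale opens"
  unfolding boolean_locale_def
proof (intro conjI frame_opens ballI)
  fix U assume "U \<in> carrier opens"
  then show "\<exists>V\<in>carrier opens. U \<sqinter>\<^bsub>opens\<^esub> V = \<bottom>\<^bsub>opens\<^esub> \<and> U \<squnion>\<^bsub>opens\<^esub> V = \<top>\<^bsub>opens\<^esub>"
    using assms
    by (intro bexI[of _ "pseudocomplement U"])
      (simp_all add: mu_ideal_pseudocomplement meet_opens join_opens bottom_opens top_opens
        Int_pseudocomplement join_pseudocomplement)
qed

section \<open>The measure\<close>

definition ideal_measure :: "'a set \<Rightarrow> ennreal" where
  "ideal_measure U = (SUP p\<in>U. ennreal (\<mu> p))"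

lemma ideal_measure_mono: "U \<subseteq> V \<Longrightarrow> ideal_measure U \<le> ideal_measure V"
  unfolding ideal_measure_def by (rule SUP_subset_mono) auto

lemma ideal_measure_upper: "p \<in> U \<Longrightarrow> ennreal (\<mu> p) \<le> ideal_measure U"
  unfolding ideal_measure_def by (rule SUP_upper)

text \<open>
  The measure of a join can thus be computed on finite joins, which reduces modularity and
  continuity to the lattice \<open>D\<close>.
\<close>

lemma ideal_measure_inner_closure: "ideal_measure (inner_closure \<mu> I) = ideal_measure I"
proof (rule antisym)
  show "ideal_measure (inner_closure \<mu> I) \<le> ideal_measure I"
    unfolding ideal_measure_def[of "inner_closure \<mu> I"]
  proof (rule SUP_least, rule ennreal_le_epsilon)
    fix p and \<epsilon> :: real
    assume p: "p \<in> inner_closure \<mu> I" and "\<epsilon> > 0"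
    then obtain q where q: "q \<in> I" "q \<le> p" "\<mu> p - \<mu> q < \<epsilon>"
      by (rule inner_closureE)
    have "ennreal (\<mu> p) \<le> ennreal (\<mu> q + \<epsilon>)"
      using q(3) by (intro ennreal_leI) simp
    also have "\<dots> = ennreal (\<mu> q) + ennreal \<epsilon>"
      using nonneg \<open>\<epsilon> > 0\<close> by simp
    also have "\<dots> \<le> ideal_measure I + ennreal \<epsilon>"
      using q(1) by (intro add_right_mono ideal_measure_upper)
    finally show "ennreal (\<mu> p) \<le> ideal_measure I + ennreal \<epsilon>" .
  qed
qed (intro ideal_measure_mono inner_closure_increasing)

lemma ideal_measure_null_ideal: "ideal_measure null_ideal = 0"
  by (simp add: null_ideal_eq ideal_measure_inner_closure) (simp add: ideal_measure_def bot)

lemma ideal_measure_sum: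
  assumes "U \<noteq> {}" "V \<noteq> {}"
  shows "ideal_measure U + ideal_measure V = (SUP p\<in>U. SUP q\<in>V. ennreal (\<mu> p + \<mu> q))"
  unfolding ideal_measure_def
  using assms nonneg
  by (simp add: ennreal_SUP_add_left[symmetric] ennreal_SUP_add_right[symmetric])

lemma ideal_measure_modular:
  assumes U: "mu_ideal \<mu> U" and V: "mu_ideal \<mu> V"
  shows "ideal_measure U + ideal_measure V = ideal_measure (ideal_join {U, V}) + ideal_measure (U \<inter> V)"
proof -
  let ?J = "finite_joins (U \<union> V)"
  have iU: "lattice_ideal U" and iV: "lattice_ideal V" and iI: "lattice_ideal (U \<inter> V)"
    using U V by (auto intro!: mu_ideal_lattice_ideal mu_ideal_Int)
  have ne: "U \<noteq> {}" "V \<noteq> {}" "U \<inter> V \<noteq> {}" "?J \<noteq> {}"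
    using iU iV iI by (auto dest: lattice_idealD(1) intro: finite_joins.bot_in)
  have "ideal_measure U + ideal_measure V = ideal_measure ?J + ideal_measure (U \<inter> V)"
  proof (rule antisym)
    show "ideal_measure U + ideal_measure V \<le> ideal_measure ?J + ideal_measure (U \<inter> V)"
      unfolding ideal_measure_sum[OF ne(1,2)]
    proof (intro SUP_least)
      fix p q assume p: "p \<in> U" and q: "q \<in> V"
      have "p \<^bold>\<or> q \<in> ?J"
        using p q by (intro finite_joins_sup finite_joins_base) auto
      moreover have "p \<^bold>\<and> q \<in> U \<inter> V"
        using p q iU iV by (meson IntI inf_le1 inf_le2 lattice_idealD(2))
      ultimately have "ennreal (\<mu> (p \<^bold>\<or> q)) + ennreal (\<mu> (p \<^bold>\<and> q)) \<le> ideal_measure ?J + ideal_measure (U \<inter> V)"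
        by (intro add_mono ideal_measure_upper)
      then show "ennreal (\<mu> p + \<mu> q) \<le> ideal_measure ?J + ideal_measure (U \<inter> V)"
        by (simp add: modular[of p q] nonneg)
    qed
    show "ideal_measure ?J + ideal_measure (U \<inter> V) \<le> ideal_measure U + ideal_measure V"
      unfolding ideal_measure_sum[OF ne(4,3)]
    proof (intro SUP_least)
      fix r t assume "r \<in> ?J" and t: "t \<in> U \<inter> V"
      then obtain u v where uv: "u \<in> U" "v \<in> V" "r = u \<^bold>\<or> v"
        using finite_joins_Un[OF iU iV] by blast
      \<comment> \<open>Enlarging both parts by \<open>t\<close> makes their meet at least \<open>t\<close>.\<close>
      have "\<mu> r \<le> \<mu> ((u \<^bold>\<or> t) \<^bold>\<or> (v \<^bold>\<or> t))" "\<mu> t \<le> \<mu> ((u \<^bold>\<or> t) \<^bold>\<and> (v \<^bold>\<or> t))"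
        unfolding uv(3) by (auto intro!: mono sup_mono)
      then have "ennreal (\<mu> r + \<mu> t) \<le> ennreal (\<mu> (u \<^bold>\<or> t) + \<mu> (v \<^bold>\<or> t))"
        using modular[of "u \<^bold>\<or> t" "v \<^bold>\<or> t"] by (intro ennreal_leI) linarith
      also have "\<dots> = ennreal (\<mu> (u \<^bold>\<or> t)) + ennreal (\<mu> (v \<^bold>\<or> t))"
        using nonneg by simp
      also have "\<dots> \<le> ideal_measure U + ideal_measure V"
        using uv t iU iV by (intro add_mono ideal_measure_upper) (auto intro: lattice_idealD(3))
      finally show "ennreal (\<mu> r + \<mu> t) \<le> ideal_measure U + ideal_measure V" .
    qed
  qed
  then show ?thesis
    by (simp add: ideal_join_def ideal_measure_inner_closure)
qed

text \<open>
  A finite join of elements of the members of a directed family lies in a single member.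
\<close>

lemma ideal_measure_directed:
  assumes "directed_family opens A"
  shows "ideal_measure (ideal_join A) = (SUP U\<in>A. ideal_measure U)"
proof (rule antisym)
  have A: "A \<noteq> {}" "\<And>U. U \<in> A \<Longrightarrow> lattice_ideal U"
      "\<And>U V. U \<in> A \<Longrightarrow> V \<in> A \<Longrightarrow> \<exists>W\<in>A. U \<subseteq> W \<and> V \<subseteq> W"
    using assms unfolding directed_family_def by (auto intro: mu_ideal_lattice_ideal)
  have "ideal_measure (finite_joins (\<Union>A)) \<le> (SUP U\<in>A. ideal_measure U)"
    unfolding ideal_measure_def[of "finite_joins (\<Union>A)"]
  proof (rule SUP_least)
    fix p assume "p \<in> finite_joins (\<Union>A)"
    then obtain U where "U \<in> A" "p \<in> U"
      using finite_joins_directed[OF A] by blast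
    then show "ennreal (\<mu> p) \<le> (SUP U\<in>A. ideal_measure U)"
      by (meson SUP_upper2 ideal_measure_upper)
  qed
  then show "ideal_measure (ideal_join A) \<le> (SUP U\<in>A. ideal_measure U)"
    by (simp add: ideal_join_def ideal_measure_inner_closure)
  show "(SUP U\<in>A. ideal_measure U) \<le> ideal_measure (ideal_join A)"
    by (intro SUP_least ideal_measure_mono ideal_join_upper)
qed

lemma locale_measure_opens: "locale_measure opens ideal_measure"
  unfolding locale_measure_def
proof (intro conjI ballI allI impI)
  show "ideal_measure \<bottom>\<^bsub>opens\<^esub> = 0"
    by (simp add: bottom_opens ideal_measure_null_ideal)
  show "ideal_measure (\<Squnion>\<^bsub>opens\<^esub>A) = (SUP U\<in>A. ideal_measure U)" if "directed_family opens A" for A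
    using ideal_measure_directed[OF that] that by (simp only: directed_family_def Sup_opens)
next
  show "ideal_measure U \<le> ideal_measure V" if "U \<sqsubseteq>\<^bsub>opens\<^esub> V" for U V
    using that by (simp add: ideal_measure_mono)
next
  fix U V assume "U \<in> carrier opens" "V \<in> carrier opens"
  then show "ideal_measure U + ideal_measure V
      = ideal_measure (U \<squnion>\<^bsub>opens\<^esub> V) + ideal_measure (U \<sqinter>\<^bsub>opens\<^esub> V)"
    by (simp only: carrier_opens join_opens meet_opens ideal_measure_modular)
qed

definition principal :: "'a \<Rightarrow> 'a set" where
  "principal p = inner_closure \<mu> {q. q \<le> p}"

lemma mu_ideal_principal: "mu_ideal \<mu> (principal p)"
  unfolding principal_def
  by (rule mu_ideal_inner_closure)
    (simp add: lattice_ideal_def down_closed_def, blast intro: order_trans)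

lemma principal_self: "p \<in> principal p"
  unfolding principal_def by (rule subsetD[OF inner_closure_increasing]) simp

text \<open>
  Among the elements below both \<open>q\<close> and \<open>p\<close> the meet is the best approximation of \<open>q\<close>, so that it
  must approximate \<open>q\<close> to any precision.
\<close>

lemma principal_inf:
  assumes "q \<in> principal p"
  shows "\<mu> q = \<mu> (q \<^bold>\<and> p)"
proof -
  have "\<mu> q \<le> \<mu> (q \<^bold>\<and> p)"
  proof (rule field_le_epsilon)
    fix \<epsilon> :: real assume "\<epsilon> > 0"
    with assms[unfolded principal_def] obtain r where "r \<in> {r. r \<le> p}" "r \<le> q" "\<mu> q - \<mu> r < \<epsilon>"
      by (rule inner_closureE)
    then show "\<mu> q \<le> \<mu> (q \<^bold>\<and> p) + \<epsilon>"
      using mono[of r "q \<^bold>\<and> p"] by simp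
  qed
  moreover have "\<mu> (q \<^bold>\<and> p) \<le> \<mu> q"
    by (simp add: mono)
  ultimately show ?thesis
    by simp
qed

lemma ideal_measure_principal: "ideal_measure (principal p) = ennreal (\<mu> p)"
proof (rule antisym)
  have "\<mu> q \<le> \<mu> p" if "q \<in> principal p" for q
    using principal_inf[OF that] mono[of "q \<^bold>\<and> p" p] by simp
  then show "ideal_measure (principal p) \<le> ennreal (\<mu> p)"
    unfolding ideal_measure_def by (intro SUP_least ennreal_leI)
qed (intro ideal_measure_upper principal_self)

lemma locally_finite_opens: "locally_finite_measure opens ideal_measure"
proof -
  have "ideal_join (range principal) = UNIV"
    using ideal_join_upper principal_self by blast
  moreover have "range principal \<subseteq> carrier opens"
    by (simp add: mu_ideal_principal)
  ultimately have "\<top>\<^bsub>opens\<^esub> = \<Squnion>\<^bsub>opens\<^esub>(range principal)"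
    by (simp only: top_opens Sup_opens)
  then show ?thesis
    unfolding locally_finite_measure_def
    by (intro exI[of _ "range principal"]) (auto simp: mu_ideal_principal ideal_measure_principal)
qed

lemma faithful_opens: "faithful_measure opens ideal_measure"
  unfolding faithful_measure_def
proof (intro ballI impI)
  fix U V
  assume "U \<in> carrier opens" "V \<in> carrier opens" "U \<sqsubseteq>\<^bsub>opens\<^esub> V"
    and eq: "\<forall>K\<in>carrier opens. ideal_measure K < \<infinity> \<longrightarrow>
      ideal_measure (U \<sqinter>\<^bsub>opens\<^esub> K) = ideal_measure (V \<sqinter>\<^bsub>opens\<^esub> K)"
  then have U: "mu_ideal \<mu> U" and V: "mu_ideal \<mu> V" and "U \<subseteq> V"
    by simp_all
  have "p \<in> U" if p: "p \<in> V" for p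
  proof (rule mu_ideal_closed[OF U], rule inner_closureI)
    fix \<epsilon> :: real assume "\<epsilon> > 0"
    have "ennreal (\<mu> p) \<le> ideal_measure (V \<inter> principal p)"
      by (simp add: ideal_measure_upper p principal_self)
    also have "\<dots> = ideal_measure (U \<inter> principal p)"
      using bspec[OF eq, of "principal p"] U V
      by (simp add: mu_ideal_principal meet_opens ideal_measure_principal)
    finally have le: "ennreal (\<mu> p) \<le> ideal_measure (U \<inter> principal p)" .
    have "\<exists>u\<in>U \<inter> principal p. \<mu> p - \<mu> u < \<epsilon>"
    proof (rule ccontr)
      assume "\<not> (\<exists>u\<in>U \<inter> principal p. \<mu> p - \<mu> u < \<epsilon>)"
      have far: "\<mu> u \<le> \<mu> p - \<epsilon>" if "u \<in> U \<inter> principal p" for u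
      proof -
        have "\<not> \<mu> p - \<mu> u < \<epsilon>"
          using \<open>\<not> (\<exists>u\<in>U \<inter> principal p. \<mu> p - \<mu> u < \<epsilon>)\<close> that by blast
        then show ?thesis
          by linarith
      qed
      have "bot \<in> U \<inter> principal p"
        by (rule lattice_idealD(1)[OF mu_ideal_lattice_ideal[OF mu_ideal_Int[OF U mu_ideal_principal]]])
      then have "0 \<le> \<mu> p - \<epsilon>"
        using far[of bot] by (simp add: bot)
      moreover have "ideal_measure (U \<inter> principal p) \<le> ennreal (\<mu> p - \<epsilon>)"
        unfolding ideal_measure_def using far by (intro SUP_least ennreal_leI)
      with le have "ennreal (\<mu> p) \<le> ennreal (\<mu> p - \<epsilon>)"
        by (rule order_trans)
      ultimately show False
        using \<open>\<epsilon> > 0\<close> by simp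
    qed
    then obtain u where u: "u \<in> U" "u \<in> principal p" "\<mu> p - \<mu> u < \<epsilon>"
      by blast
    \<comment> \<open>The element \<open>u\<close> need not lie below \<open>p\<close>, but its meet with \<open>p\<close> has the same measure.\<close>
    have "u \<^bold>\<and> p \<in> U"
      using u(1) U by (meson inf_le1 lattice_idealD(2) mu_ideal_lattice_ideal)
    then show "\<exists>q\<in>U. q \<le> p \<and> \<mu> p - \<mu> q < \<epsilon>"
      using u(3) principal_inf[OF u(2)] by (intro bexI[of _ "u \<^bold>\<and> p"]) auto
  qed
  with \<open>U \<subseteq> V\<close> show "U = V"
    by blast
qed

end

section \<open>Measurability of the inner locale\<close>

theorem theorem1p4:
  fixes \<mu> :: "'a :: {distrib_lattice, order_bot} \<Rightarrow> real"
  assumes "valuation_site \<mu>"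
    and "almost_boolean \<mu>"
  shows "measurable_locale (inner_locale \<mu>)"
proof -
  interpret valuation_site \<mu>
    by (rule assms(1))
  show ?thesis
    unfolding measurable_locale_def
    using boolean_locale_opens[OF assms(2)] locale_measure_opens locally_finite_opens faithful_opens
    by blast
qed

end
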